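(* Let $U$ be an associative commutative algebra over a field of characteristic $p$ and let $D\in \mathrm{Der}\,U$ be a derivation of $U$. If $p=3$, then the multiplication $D^2\wedge D^3:(u,v)\mapsto D^2(u)D^3(v)-D^2(v)D^3(u)$ endows $U$ with the structure of a Lie algebra. If $p=2$, then for every integer $k\ge 0$ the multiplication $D^{2^k}\wedge D^{2^k-1}:(u,v)\mapsto D^{2^k}(u)D^{2^k-1}(v)-D^{2^k-1}(u)D^{2^k}(v)$ endows $U$ with the structure of a Lie algebra.
   Context: $D^i$ denotes the $i$-th iterate of $D$ (with $D^0=\mathrm{id}$). A Lie algebra structure is a bilinear alternating product satisfying the Jacobi identity. *)

theory Defs
  imports Complex_Main
begin

text \<open>
  The class \<^class>\<open>comm_ring\<close> does not require a unit, so the algebras below need not be unital.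
  Compatibility of scalars with the second factor follows by commutativity.
\<close>

locale comm_assoc_algebra = vector_space scale
  for scale :: "'k::field \<Rightarrow> 'u::comm_ring \<Rightarrow> 'u" +
  assumes scale_mult: "scale a (x * y) = scale a x * y"

locale algebra_derivation =
  comm_assoc_algebra scale + Vector_Spaces.linear scale scale D
  for scale :: "'k::field \<Rightarrow> 'u::comm_ring \<Rightarrow> 'u" and D :: "'u \<Rightarrow> 'u" +
  assumes leibniz: "D (x * y) = D x * y + x * D y"

locale lie_algebra = vector_space scale
  for scale :: "'k::field \<Rightarrow> 'u::ab_group_add \<Rightarrow> 'u"
    and bracket :: "'u \<Rightarrow> 'u \<Rightarrow> 'u" +
  assumes linear_left: "Vector_Spaces.linear scale scale (\<lambda>x. bracket x y)"
    and linear_right: "Vector_Spaces.linear scale scale (\<lambda>y. bracket x y)"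
    and alternating: "bracket x x = 0"
    and jacobi: "bracket (bracket x y) z + bracket (bracket y z) x + bracket (bracket z x) y = 0"

end

theory Submission
  imports Defs
begin

text \<open>
  In characteristic \<open>p\<close> the iterate \<open>D ^^ p\<close> is again a derivation.
  For \<open>p = 2\<close> and \<open>q = 2 ^ k\<close> the bracket of \<open>u\<close> and \<open>v\<close> is \<open>D (a * b)\<close> with
  \<open>a = (D ^^ (q - 1)) u\<close> and \<open>b = (D ^^ (q - 1)) v\<close>, so a double bracket is
  \<open>D ((D ^^ q) (a * b) * c)\<close>; expanding by the Leibniz rule for \<open>D ^^ q\<close>, every term of the
  Jacobi sum occurs twice.
  For \<open>p = 3\<close> the bracket is the Wronskian \<open>a * D b - b * D a\<close> of \<open>a = (D ^^ 2) u\<close> and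
  \<open>b = (D ^^ 2) v\<close>. The double bracket involves \<open>D ^^ 2\<close> and \<open>D ^^ 3\<close> of the Wronskian, and
  once \<open>D ^^ 3\<close> is known to be a derivation, the Jacobi sum cancels over the integers.
\<close>

context algebra_derivation
begin

lemma funpow_D_add: "(D ^^ n) (x + y) = (D ^^ n) x + (D ^^ n) y"
  by (induction n) (simp_all add: add)

lemma funpow_D_scale: "(D ^^ n) (scale a x) = scale a ((D ^^ n) x)"
  by (induction n) (simp_all add: scale)

lemma scale_mult_right: "scale a (x * y) = x * scale a y"
  using scale_mult[of a y x] by (simp add: mult.commute)

lemma wedge_linear_left:
  "Vector_Spaces.linear scale scale (\<lambda>u. (D ^^ m) u * (D ^^ n) v - (D ^^ n) u * (D ^^ m) v)"
  by (simp add: Vector_Spaces.linear_iff vector_space_axioms funpow_D_add funpow_D_scale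
      scale_right_diff_distrib scale_mult[symmetric] scale_mult_right[symmetric] algebra_simps)

lemma wedge_linear_right:
  "Vector_Spaces.linear scale scale (\<lambda>v. (D ^^ m) u * (D ^^ n) v - (D ^^ n) u * (D ^^ m) v)"
  by (simp add: Vector_Spaces.linear_iff vector_space_axioms funpow_D_add funpow_D_scale
      scale_right_diff_distrib scale_mult[symmetric] scale_mult_right[symmetric] algebra_simps)

text \<open>Bilinearity and alternation hold for every wedge of iterates, so only Jacobi is left to
  check. Taking \<open>bracket\<close> up to an equation allows its factors in another
  order.\<close>

lemma lie_algebra_wedgeI:
  assumes "\<And>u v. bracket u v = (D ^^ m) u * (D ^^ n) v - (D ^^ n) u * (D ^^ m) v"
    and "\<And>x y z. bracket (bracket x y) z + bracket (bracket y z) x + bracket (bracket z x) y = 0"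
  shows "lie_algebra scale bracket"
proof -
  have B: "bracket = (\<lambda>u v. (D ^^ m) u * (D ^^ n) v - (D ^^ n) u * (D ^^ m) v)"
    using assms(1) by blast
  show ?thesis
  proof (intro lie_algebra.intro lie_algebra_axioms.intro vector_space_axioms)
    show "bracket x x = 0" for x
      by (simp add: B mult.commute)
  qed (use assms(2) in \<open>simp_all only: B wedge_linear_left wedge_linear_right\<close>)
qed

lemma char_2_add_self:
  assumes "CHAR('k) = 2"
  shows "(x::'u) + x = 0"
proof -
  have "of_nat 2 = (0::'k)"
    using of_nat_CHAR[where 'a = 'k] assms by simp
  \<comment> \<open>The characteristic is that of the field; scalars carry it over to a ring that
    may lack a unit.\<close>
  then have "scale (1 + 1) x = 0"
    by simp
  then show ?thesis
    by (simp only: scale_left_distrib scale_one)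
qed

lemma char_3_add_self:
  assumes "CHAR('k) = 3"
  shows "(x::'u) + (x + x) = 0"
proof -
  have "of_nat 3 = (0::'k)"
    using of_nat_CHAR[where 'a = 'k] assms by simp
  then have "scale (1 + (1 + 1)) x = 0"
    by simp
  then show ?thesis
    by (simp only: scale_left_distrib scale_one)
qed

text \<open>Doubling the exponent squares a derivation \<open>E\<close>, and the cross term
  \<open>E x * E y\<close> then occurs twice.\<close>

lemma char_2_leibniz_funpow:
  assumes "CHAR('k) = 2"
  shows "(D ^^ (2 ^ k)) (x * y) = (D ^^ (2 ^ k)) x * y + x * (D ^^ (2 ^ k)) y"
proof (induction k arbitrary: x y)
  case 0
  show ?case by (simp add: leibniz)
next
  case (Suc k)
  define E where "E = D ^^ (2 ^ k)"
  have IH: "E (x * y) = E x * y + x * E y" for x y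
    unfolding E_def by (rule Suc.IH)
  have E_add: "E (x + y) = E x + E y" for x y
    unfolding E_def by (rule funpow_D_add)
  have EE: "(D ^^ (2 ^ Suc k)) x = E (E x)" for x
    by (simp add: E_def mult_2 funpow_add)
  have "E (E (x * y)) = E (E x) * y + x * E (E y) + (E x * E y + E x * E y)"
    by (simp add: IH E_add ac_simps)
  then show ?case
    by (simp only: EE char_2_add_self[OF assms] add_0_right)
qed

text \<open>Both mixed terms carry the binomial coefficient 3.\<close>

lemma char_3_leibniz_funpow_3:
  assumes "CHAR('k) = 3"
  shows "D (D (D (x * y))) = D (D (D x)) * y + x * D (D (D y))"
proof -
  have "D (D (D (x * y))) = D (D (D x)) * y + x * D (D (D y))
      + (D (D x) * D y + (D (D x) * D y + D (D x) * D y))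
      + (D x * D (D y) + (D x * D (D y) + D x * D (D y)))"
    by (simp add: leibniz add ac_simps)
  then show ?thesis
    by (simp only: char_3_add_self[OF assms] add_0_right)
qed

lemma char_2_lie_algebra:
  assumes "CHAR('k) = 2"
  shows "lie_algebra scale (\<lambda>u v. (D ^^ (2 ^ k)) u * (D ^^ (2 ^ k - 1)) v
                                - (D ^^ (2 ^ k - 1)) u * (D ^^ (2 ^ k)) v)"
    (is "lie_algebra scale ?B")
proof (rule lie_algebra_wedgeI[OF refl])
  fix x y z
  define F where "F = D ^^ (2 ^ k - 1)"
  \<comment> \<open>The subtraction on naturals is not truncated, since \<open>2 ^ k\<close> is at
    least 1.\<close>
  have pow: "D ^^ (2 ^ k) = D ^^ Suc (2 ^ k - 1)"
    by simp
  have DF: "(D ^^ (2 ^ k)) u = D (F u)" for u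
    unfolding pow F_def by (simp only: funpow.simps o_apply)
  have FD: "F (D u) = (D ^^ (2 ^ k)) u" for u
    unfolding pow F_def by (simp only: funpow_Suc_right o_apply)
  have minus: "- u = u" for u :: 'u
    using char_2_add_self[OF assms, of u] by (simp add: minus_unique)
  have B: "?B u v = D (F u * F v)" for u v
  proof -
    have "?B u v = D (F u) * F v + - (F u * D (F v))"
      by (simp only: DF F_def[symmetric] add_uminus_conv_diff)
    then show ?thesis
      by (simp only: minus leibniz)
  qed
  have BB: "?B (?B u v) w =
      D (D (F (F u)) * F v * F w + F u * D (F (F v)) * F w)" for u v w
    unfolding B FD char_2_leibniz_funpow[OF assms] by (simp add: DF algebra_simps)
  \<comment> \<open>In each term \<open>D ^^ (2 ^ k)\<close> hits one of the three factors; each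
    term comes from two of the three double brackets.\<close>
  let ?a = "D (F (F x)) * F y * F z" and ?b = "F x * D (F (F y)) * F z"
    and ?c = "F x * F y * D (F (F z))"
  have "?B (?B x y) z + ?B (?B y z) x + ?B (?B z x) y
      = D ((?a + ?a) + (?b + ?b) + (?c + ?c))"
    unfolding BB by (simp add: add ac_simps)
  then show "?B (?B x y) z + ?B (?B y z) x + ?B (?B z x) y = 0"
    by (simp only: char_2_add_self[OF assms] add_0_right zero)
qed

lemma char_3_lie_algebra:
  assumes "CHAR('k) = 3"
  shows "lie_algebra scale (\<lambda>u v. (D ^^ 2) u * (D ^^ 3) v - (D ^^ 2) v * (D ^^ 3) u)"
    (is "lie_algebra scale ?B")
proof (rule lie_algebra_wedgeI)
  show "?B u v = (D ^^ 2) u * (D ^^ 3) v - (D ^^ 3) u * (D ^^ 2) v" for u v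
    by (simp add: mult.commute)
next
  fix x y z
  define W where "W a b = a * D b - b * D a" for a b
  have B: "?B u v = W (D (D u)) (D (D v))" for u v
    by (simp add: W_def numeral_2_eq_2 numeral_3_eq_3)
  have D2: "D (D (W a b)) = a * D (D (D b)) - b * D (D (D a))
      + D a * D (D b) - D b * D (D a)" for a b
    by (simp add: W_def leibniz add diff algebra_simps)
  have D3: "D (D (D (W a b))) = D (D (D a)) * D b + a * D (D (D (D b)))
      - D (D (D b)) * D a - b * D (D (D (D a)))" for a b
    by (simp add: W_def diff char_3_leibniz_funpow_3[OF assms] algebra_simps)
  have WW: "W (D (D (W a b))) c =
     (a * D (D (D b)) - b * D (D (D a)) + D a * D (D b) - D b * D (D a)) * D c
     - c * (D (D (D a)) * D b + a * D (D (D (D b)))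
      - D (D (D b)) * D a - b * D (D (D (D a))))" for a b c
    \<comment> \<open>Only the outer \<open>W\<close> is opened, so that \<open>D3\<close> and
      \<open>D2\<close> still match; \<open>D3\<close> goes first because \<open>D2\<close> would
      rewrite inside its left-hand side.\<close>
    unfolding W_def[of "D (D (W a b))"] D3 unfolding D2 ..
  show "?B (?B x y) z + ?B (?B y z) x + ?B (?B z x) y = 0"
    unfolding B WW by (simp add: algebra_simps)
qed

end

theorem corollary1p4:
  fixes scale :: "'k::field \<Rightarrow> 'u::comm_ring \<Rightarrow> 'u"
    and D :: "'u \<Rightarrow> 'u"
    and p :: nat
  assumes "CHAR('k) = p"
    and "comm_assoc_algebra scale"
    and "algebra_derivation scale D"
  shows "(p = 3 \<longrightarrow>
            lie_algebra scale
              (\<lambda>u v. (D ^^ 2) u * (D ^^ 3) v - (D ^^ 2) v * (D ^^ 3) u)) \<and>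
         (p = 2 \<longrightarrow>
            (\<forall>k::nat. lie_algebra scale
              (\<lambda>u v. (D ^^ (2 ^ k)) u * (D ^^ (2 ^ k - 1)) v
                   - (D ^^ (2 ^ k - 1)) u * (D ^^ (2 ^ k)) v)))"
  using assms(1) algebra_derivation.char_3_lie_algebra[OF assms(3)]
    algebra_derivation.char_2_lie_algebra[OF assms(3)]
  by blast

end
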